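(* For every $b>1$, the randomized $b$-scaling strategy $R_b$ is $\frac{\sqrt b+2b-1}{\sqrt b\,\log b}$-competitive for single-machine scheduling minimizing $\sum_j w_jC_j$ in the non-clairvoyant kill-and-restart model, i.e., $\mathbb{E}[R_b(I)]\leq \frac{\sqrt b+2b-1}{\sqrt b\,\log b}\,\mathrm{OPT}(I)$ for every instance $I$, where $\log$ is the natural logarithm. This ratio is minimized for $b\approx 8.16$, yielding a performance guarantee $<3.032$.
   Context: An instance $I=(\vec p,\vec w)$ consists of $n$ jobs with processing times $p_j>0$ and weights $w_j>0$ on a single machine; objective $\sum_j w_jC_j$; $\mathrm{OPT}(I)$ is the optimal clairvoyant objective value (non-preemptive order of nondecreasing $p_j/w_j$). Kill-and-restart model: a non-clairvoyant strategy probes jobs one at a time; a probing of $j$ for time $\tau$ completes $j$ after $p_j$ time units if $\tau\geq p_j$, otherwise it is aborted after $\tau$ time units and all progress is lost. For a permutation $\sigma$ of $[n]$ and $\xi\in[0,1]$, the strategy $D_b^{\sigma,\xi}$ proceeds in rounds $q\in\mathbb{Z}$ in increasing order starting from $-\infty$; in round $q$ every not yet completed job $j$ is probed, in the order given by $\sigma$, for time $w_jb^{q+\xi}$; probings run back to back from time $0$ without idling (formally the limit as $q_0\to-\infty$ of the algorithm starting with round $q_0$, so at the start of round $q$ each unfinished job $j$ has been probed for total time $w_jb^{q+\xi}/(b-1)$). $R_b:=D_b^{\Sigma,\Xi}$ where $\Sigma$ is a uniformly random permutation and $\Xi$ is uniform on $[0,1]$, independent; $R_b(I)$ denotes its objective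 value (a random variable). *)

theory Defs
  imports "HOL-Probability.Probability"
begin

text \<open>
  An instance is a triple \<open>n\<close>, \<open>p\<close>, \<open>w\<close>: the jobs are the numbers \<open>j < n\<close>, with processing times
  \<open>p j\<close> and weights \<open>w j\<close>; the values of \<open>p\<close> and \<open>w\<close> outside \<open>{..<n}\<close> are irrelevant. An order of
  the jobs is a list in \<open>permutations_of_set {..<n}\<close>.
\<close>

definition instance_ok :: "nat \<Rightarrow> (nat \<Rightarrow> real) \<Rightarrow> (nat \<Rightarrow> real) \<Rightarrow> bool" where
  "instance_ok n p w \<longleftrightarrow> (\<forall>j<n. 0 < p j \<and> 0 < w j)"

text \<open>Weighted sum of completion times of the non-preemptive schedule without idle time that starts
  at time \<open>t\<close> and processes the jobs in list order.\<close>

fun list_schedule_cost :: "(nat \<Rightarrow> real) \<Rightarrow> (nat \<Rightarrow> real) \<Rightarrow> real \<Rightarrow> nat list \<Rightarrow> real" where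
  "list_schedule_cost p w t [] = 0"
| "list_schedule_cost p w t (j # js) =
     w j * (t + p j) + list_schedule_cost p w (t + p j) js"

definition OPT :: "nat \<Rightarrow> (nat \<Rightarrow> real) \<Rightarrow> (nat \<Rightarrow> real) \<Rightarrow> real" where
  "OPT n p w = Min (list_schedule_cost p w 0 ` permutations_of_set {..<n})"

text \<open>The state of a kill-and-restart schedule: the current time, and the completion times of the
  jobs completed so far. An aborted probing leaves no trace but the time it took.\<close>

type_synonym kr_state = "real \<times> (nat \<rightharpoonup> real)"

fun probe :: "(nat \<Rightarrow> real) \<Rightarrow> nat \<Rightarrow> real \<Rightarrow> kr_state \<Rightarrow> kr_state" where
  "probe p j \<tau> (t, C) =
     (if p j \<le> \<tau> then (t + p j, C(j \<mapsto> t + p j)) else (t + \<tau>, C))"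

text \<open>Round \<open>q\<close> of the strategy with order \<open>\<sigma>\<close> and offset \<open>\<xi>\<close>. The processing times \<open>p\<close> are used by
  \<open>probe\<close> only; the strategy itself sees just the set of completed jobs.\<close>

definition scaling_round ::
  "real \<Rightarrow> nat list \<Rightarrow> real \<Rightarrow> (nat \<Rightarrow> real) \<Rightarrow> (nat \<Rightarrow> real) \<Rightarrow> int \<Rightarrow> kr_state \<Rightarrow> kr_state" where
  "scaling_round b \<sigma> \<xi> p w q =
     fold (\<lambda>j s. if j \<in> dom (snd s) then s
                 else probe p j (w j * b powr (real_of_int q + \<xi>)) s) \<sigma>"

text \<open>The state after the rounds \<open>q0, \<dots>, q1\<close>, started with round \<open>q0\<close> at time 0.\<close>

definition scaling_run ::
  "real \<Rightarrow> nat list \<Rightarrow> real \<Rightarrow> (nat \<Rightarrow> real) \<Rightarrow> (nat \<Rightarrow> real) \<Rightarrow> int \<Rightarrow> int \<Rightarrow> kr_state" where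
  "scaling_run b \<sigma> \<xi> p w q0 q1 = fold (scaling_round b \<sigma> \<xi> p w) [q0..q1] (0, Map.empty)"

text \<open>The completion time of \<open>j\<close> when starting with round \<open>q0\<close>. It is unique since completed jobs are
  not probed again; it exists for every job in \<open>\<sigma>\<close> with positive weight if \<open>b > 1\<close>.\<close>

definition completion_from ::
  "real \<Rightarrow> nat list \<Rightarrow> real \<Rightarrow> (nat \<Rightarrow> real) \<Rightarrow> (nat \<Rightarrow> real) \<Rightarrow> int \<Rightarrow> nat \<Rightarrow> real" where
  "completion_from b \<sigma> \<xi> p w q0 j =
     (THE c. \<exists>q1. snd (scaling_run b \<sigma> \<xi> p w q0 q1) j = Some c)"

definition scaling_completion ::
  "real \<Rightarrow> nat list \<Rightarrow> real \<Rightarrow> (nat \<Rightarrow> real) \<Rightarrow> (nat \<Rightarrow> real) \<Rightarrow> nat \<Rightarrow> real" where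
  "scaling_completion b \<sigma> \<xi> p w j = Lim at_bot (\<lambda>q0. completion_from b \<sigma> \<xi> p w q0 j)"

definition scaling_cost ::
  "real \<Rightarrow> nat \<Rightarrow> (nat \<Rightarrow> real) \<Rightarrow> (nat \<Rightarrow> real) \<Rightarrow> nat list \<times> real \<Rightarrow> real" where
  "scaling_cost b n p w = (\<lambda>(\<sigma>, \<xi>). \<Sum>j<n. w j * scaling_completion b \<sigma> \<xi> p w j)"

text \<open>The joint distribution of the independent pair of a uniform order and a uniform offset; the
  objective value of the randomized strategy is the random variable \<open>scaling_cost b n p w\<close> on it.\<close>

definition scaling_space :: "nat \<Rightarrow> (nat list \<times> real) measure" where
  "scaling_space n =
     measure_pmf (pmf_of_set (permutations_of_set {..<n})) \<Otimes>\<^sub>M uniform_measure lborel {0..1}"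

definition scaling_ratio :: "real \<Rightarrow> real" where
  "scaling_ratio b = (sqrt b + 2 * b - 1) / (sqrt b * ln b)"

end

theory Submission
  imports Defs
begin

text \<open>
  Adding up the costs for an order and its reverse removes the order from the cost, which becomes a
  sum over pairs of jobs. With \<open>r j = p j / w j\<close> and \<open>Q = (\<Sum>j k. w j * w k * min (r j) (r k))\<close>,
  integrating over the offset turns the doubled cost, apart from \<open>(\<Sum>j. w j * p j)\<close>, into a
  nonnegative mixture of the sums \<open>(\<Sum>j k. w j * w k * min (r j) (l * r k))\<close> with \<open>1 \<le> l \<le> b\<close>.
  Each of these is at most \<open>sqrt l * Q\<close>, and the mixture of the factors \<open>sqrt l\<close> is the claimed
  ratio. A bound for single pairs of jobs would give a larger ratio. Finally,
  \<open>Q + (\<Sum>j. w j * p j)\<close> is at most twice the optimum.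
\<close>

section \<open>The ratio\<close>

text \<open>The only nontrivial estimate available for the sums
  \<open>M l = (\<Sum>j k. w j * w k * min (r j) (l * r k))\<close> is an upper bound, so they may
  enter the integrated cost only with nonnegative coefficients. The raw integral over the offset
  also contains negative terms. For a single pair they combine with the aborted probings so that
  what remains is exactly the mixture with mass \<open>1 / ln b\<close> at \<open>l = 1\<close>,
  mass \<open>1 / (b * ln b)\<close> at \<open>l = b\<close>, and density
  \<open>1 + b powr (- u)\<close> in \<open>u\<close> at \<open>l = b powr u\<close>, for
  \<open>u\<close> in \<open>{0..1}\<close>. A pair with ratios \<open>x\<close> and
  \<open>y \<ge> l * x\<close> contributes \<open>(1 + l) * min x y\<close> to the symmetrized sum,
  more than the \<open>2 * sqrt l * min x y\<close> allowed on average. The diagonal terms and the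
  pairs of similar ratio contribute less, and only the whole sum satisfies the bound with
  \<open>sqrt l\<close>. Hence the integral over \<open>u\<close> is left unevaluated for single
  pairs and is estimated after summation. Expectations also require measurability and integrability
  of the cost. The first is derived from the operational definition, the second from
  boundedness.\<close>

lemma ln_2_8557_le: "ln (2.8557::real) \<le> 1.04933"
  using ln_approx_bounds[of "2.8557" 7] by (simp add: eval_nat_numeral)
lemma ln_2_857_ge: "(1.0497::real) \<le> ln 2.857"
  using ln_approx_bounds[of "2.857" 7] by (simp add: eval_nat_numeral)
lemma ln_2_8574_ge: "(1.04989::real) \<le> ln 2.8574"
  using ln_approx_bounds[of "2.8574" 7] by (simp add: eval_nat_numeral)

text \<open>The derivative of \<open>root_ratio\<close> without its positive factor
  \<open>1 / (2 * (ln s)^2)\<close>. Being increasing, it changes sign at most once, so a zero of it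
  is the unique global minimizer.\<close>

definition ratio_slope :: "real \<Rightarrow> real" where
  "ratio_slope s = (2 + 1 / s^2) * ln s - (1 / s + 2 - 1 / s^2)"

lemma ratio_slope_strict_mono:
  assumes "1 \<le> s" "s < t"
  shows "ratio_slope s < ratio_slope t"
proof (rule DERIV_pos_imp_increasing[OF assms(2)])
  fix x assume x: "s \<le> x" "x \<le> t"
  then have x1: "1 \<le> x" using assms by simp
  have "(ratio_slope has_real_derivative (2 * x^2 - 1 + x - 2 * ln x) / x^3) (at x)"
    unfolding ratio_slope_def using x1
    by (auto intro!: derivative_eq_intros simp: field_simps power_numeral_reduce)
  moreover have "2 * x^2 - 1 + x - 2 * ln x > 0"
  proof -
    have "ln x \<le> x - 1" using x1 by (intro ln_le_minus_one) simp
    moreover have "x * 1 \<le> x * x" using x1 by (intro mult_left_mono) simp_all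
    ultimately show ?thesis using x1 unfolding power2_eq_square by linarith
  qed
  ultimately show "\<exists>y. (ratio_slope has_real_derivative y) (at x) \<and> 0 < y"
    using x1 by (intro exI conjI) auto
qed

text \<open>The competitive ratio after the substitution \<open>s = sqrt b\<close>, which leaves
  \<open>ln s\<close> and rational functions of \<open>s\<close>.\<close>

definition root_ratio :: "real \<Rightarrow> real" where
  "root_ratio s = (1 + 2 * s - 1 / s) / (2 * ln s)"

lemma scaling_ratio_root: "1 < b \<Longrightarrow> scaling_ratio b = root_ratio (sqrt b)"
  by (simp add: scaling_ratio_def root_ratio_def ln_sqrt field_simps)

lemma root_ratio_deriv:
  assumes "1 < s"
  shows "(root_ratio has_real_derivative ratio_slope s / (2 * (ln s)^2)) (at s)"
proof -
  have "ln s > 0" using assms by simp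
  then show ?thesis
    unfolding root_ratio_def ratio_slope_def using assms
    by (auto intro!: derivative_eq_intros simp: field_simps power_numeral_reduce)
qed

lemma root_ratio_minimal:
  assumes s: "1 < s" "ratio_slope s = 0" and t: "1 < t" "t \<noteq> s"
  shows "root_ratio s < root_ratio t"
proof (cases "t < s")
  case True
  have "isCont root_ratio x" if "1 < x" for x
    using root_ratio_deriv[OF that] by (rule DERIV_isCont)
  with True t(1) show ?thesis
  proof (intro DERIV_neg_imp_decreasing_open[OF True])
    fix x assume x: "t < x" "x < s"
    then have "ratio_slope x < 0" using ratio_slope_strict_mono[of x s] t s by simp
    moreover have "ln x > 0" using x t by simp
    ultimately have "ratio_slope x / (2 * (ln x)^2) < 0" by (intro divide_neg_pos) auto
    then show "\<exists>y. DERIV root_ratio x :> y \<and> y < 0"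
      using root_ratio_deriv[of x] x t by (intro exI conjI) auto
  qed (auto intro!: continuous_at_imp_continuous_on)
next
  case False
  with t have ts: "s < t" by simp
  have "isCont root_ratio x" if "1 < x" for x
    using root_ratio_deriv[OF that] by (rule DERIV_isCont)
  with s(1) show ?thesis
  proof (intro DERIV_pos_imp_increasing_open[OF ts])
    fix x assume x: "s < x" "x < t"
    then have "ratio_slope x > 0" using ratio_slope_strict_mono[of s x] s by simp
    moreover have "ln x > 0" using x s by simp
    ultimately have "ratio_slope x / (2 * (ln x)^2) > 0" by (intro divide_pos_pos) auto
    then show "\<exists>y. DERIV root_ratio x :> y \<and> y > 0"
      using root_ratio_deriv[of x] x s by (intro exI conjI) auto
  qed (auto intro!: continuous_at_imp_continuous_on)
qed

lemma scaling_ratio_minimum: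
  "\<exists>b0>1. (\<forall>b>1. b \<noteq> b0 \<longrightarrow> scaling_ratio b0 < scaling_ratio b) \<and>
     \<bar>b0 - 8.16\<bar> \<le> 0.005 \<and> scaling_ratio b0 < 3.032"
proof -
  \<comment> \<open>The endpoints lie just inside the square roots of 8.155 and 8.165, so a zero
    between them gives \<open>s^2\<close> within 0.005 of 8.16. The point 2.857 used below is close
    to the minimizer and serves to bound the minimum from above.\<close>
  have "ratio_slope 2.8557 \<le> 0"
  proof -
    have "(2 + 1 / 2.8557^2) * ln (2.8557::real) \<le> (2 + 1 / 2.8557^2) * 1.04933"
      by (rule mult_left_mono[OF ln_2_8557_le]) simp
    then show ?thesis by (simp add: ratio_slope_def power2_eq_square)
  qed
  moreover have "0 \<le> ratio_slope 2.8574"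
  proof -
    have "(2 + 1 / 2.8574^2) * 1.04989 \<le> (2 + 1 / 2.8574^2) * ln (2.8574::real)"
      by (rule mult_left_mono[OF ln_2_8574_ge]) simp
    then show ?thesis by (simp add: ratio_slope_def power2_eq_square)
  qed
  moreover have "continuous_on {2.8557..2.8574} ratio_slope"
    unfolding ratio_slope_def by (auto intro!: continuous_intros)
  ultimately obtain s where s: "2.8557 \<le> s" "s \<le> 2.8574" "ratio_slope s = 0"
    using IVT'[of ratio_slope "2.8557" 0 "2.8574"] by auto
  have s1: "1 < s" using s by simp
  have "2.8557^2 \<le> s^2" "s^2 \<le> 2.8574^2" using s by (auto intro!: power_mono)
  then have close: "\<bar>s^2 - 8.16\<bar> \<le> 0.005"
    unfolding power2_eq_square abs_le_iff by simp
  have root: "scaling_ratio (s^2) = root_ratio s"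
    using s1 by (subst scaling_ratio_root) (auto simp: one_less_power)
  have "scaling_ratio (s^2) < scaling_ratio b" if b: "1 < b" "b \<noteq> s^2" for b
    unfolding root scaling_ratio_root[OF b(1)] using b
    by (intro root_ratio_minimal s1 s) (auto simp: real_sqrt_gt_1_iff)
  moreover have "root_ratio s \<le> root_ratio 2.857"
    using root_ratio_minimal[OF s1 s(3), of "2.857"] less_imp_le by fastforce
  moreover have "root_ratio 2.857 < 3.032"
    using ln_2_857_ge by (simp add: root_ratio_def divide_less_eq)
  ultimately show ?thesis
    using s1 close root by (intro exI[of _ "s^2"]) (auto simp: one_less_power)
qed

text \<open>The term \<open>(\<Sum>j. w j * p j)\<close> enters the doubled cost with coefficient 1.
  This inequality allows it to be charged with the full ratio.\<close>

lemma scaling_ratio_ge_1: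
  assumes "1 < b" shows "1 \<le> scaling_ratio b"
proof -
  define s where "s = sqrt b"
  have s: "1 < s" using assms by (simp add: s_def)
  have "ln s \<le> s - 1" "1 / s < 1" using s by (auto intro!: ln_le_minus_one)
  then have "2 * ln s \<le> 1 + 2 * s - 1 / s" by linarith
  then show ?thesis
    using s by (simp add: scaling_ratio_root[OF assms] root_ratio_def flip: s_def)
qed

section \<open>The optimum and sums of minima\<close>

text \<open>In any order, of two jobs the earlier one delays the later one by its processing time,
  at a cost of at least \<open>w j * w k\<close> times the smaller ratio. The double sum counts each
  pair twice and its diagonal is \<open>(\<Sum>j. w j * p j)\<close>, which explains the added term
  and the division by 2. The start time \<open>t\<close> is general for the induction.\<close>

lemma list_schedule_cost_ge:
  assumes "distinct js" "\<And>j. j \<in> set js \<Longrightarrow> 0 < p j \<and> 0 < w j"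
  shows "t * (\<Sum>j\<in>set js. w j) +
     ((\<Sum>j\<in>set js. \<Sum>k\<in>set js. w j * w k * min (p j / w j) (p k / w k)) +
      (\<Sum>j\<in>set js. w j * p j)) / 2 \<le> list_schedule_cost p w t js"
  using assms
proof (induction js arbitrary: t)
  case Nil
  then show ?case by simp
next
  case (Cons i js)
  define m where "m = (\<lambda>j k. w j * w k * min (p j / w j) (p k / w k))"
  define A where "A = set js"
  have A: "finite A" "i \<notin> A" using Cons.prems by (auto simp: A_def)
  have pos: "0 < p i" "0 < w i" using Cons.prems(2)[of i] by auto
  have row: "(\<Sum>k\<in>A. m i k) \<le> p i * (\<Sum>k\<in>A. w k)"
    unfolding sum_distrib_left
  proof (rule sum_mono)
    fix k assume "k \<in> A"
    then have "0 < w k" using Cons.prems(2)[of k] by (auto simp: A_def)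
    then have "m i k \<le> w i * w k * (p i / w i)"
      unfolding m_def using pos by (intro mult_left_mono) auto
    then show "m i k \<le> p i * w k" using pos by (simp add: field_simps)
  qed
  have sym: "(\<Sum>k\<in>A. m k i) = (\<Sum>k\<in>A. m i k)"
    by (intro sum.cong) (auto simp: m_def min.commute mult_ac)
  have "m i i = w i * p i" using pos by (simp add: m_def)
  then have "(\<Sum>j\<in>insert i A. \<Sum>k\<in>insert i A. m j k)
      = w i * p i + 2 * (\<Sum>k\<in>A. m i k) + (\<Sum>j\<in>A. \<Sum>k\<in>A. m j k)"
    using A by (simp add: sum.distrib sym)
  moreover have "(t + p i) * (\<Sum>j\<in>A. w j) +
     ((\<Sum>j\<in>A. \<Sum>k\<in>A. m j k) + (\<Sum>j\<in>A. w j * p j)) / 2 \<le> list_schedule_cost p w (t + p i) js"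
    using Cons.IH[of "t + p i"] Cons.prems by (auto simp: A_def m_def)
  moreover have ins: "(\<Sum>j\<in>insert i A. w j) = w i + (\<Sum>j\<in>A. w j)"
    "(\<Sum>j\<in>insert i A. w j * p j) = w i * p i + (\<Sum>j\<in>A. w j * p j)"
    using A by simp_all
  moreover have dist: "t * (w i + (\<Sum>j\<in>A. w j)) = t * w i + t * (\<Sum>j\<in>A. w j)"
    "(t + p i) * (\<Sum>j\<in>A. w j) = t * (\<Sum>j\<in>A. w j) + p i * (\<Sum>j\<in>A. w j)"
    "list_schedule_cost p w t (i # js) =
       t * w i + w i * p i + list_schedule_cost p w (t + p i) js"
    by (simp_all add: algebra_simps)
  ultimately have "t * (\<Sum>j\<in>insert i A. w j) +
     ((\<Sum>j\<in>insert i A. \<Sum>k\<in>insert i A. m j k) + (\<Sum>j\<in>insert i A. w j * p j)) / 2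
     \<le> list_schedule_cost p w t (i # js)"
    using row unfolding ins dist
    by (simp only: add_divide_distrib mult_2)
  then show ?case by (simp only: m_def A_def list.set)
qed

lemma OPT_ge:
  assumes "instance_ok n p w"
  shows "((\<Sum>j<n. \<Sum>k<n. w j * w k * min (p j / w j) (p k / w k)) + (\<Sum>j<n. w j * p j)) / 2
     \<le> OPT n p w"
proof -
  have "((\<Sum>j<n. \<Sum>k<n. w j * w k * min (p j / w j) (p k / w k)) + (\<Sum>j<n. w j * p j)) / 2
     \<le> list_schedule_cost p w 0 js" if "js \<in> permutations_of_set {..<n}" for js
    using list_schedule_cost_ge[of js p w 0] that assms
    by (auto simp: permutations_of_set_def instance_ok_def)
  then show ?thesis unfolding OPT_def by (subst Min_ge_iff) auto
qed

text \<open>Writing \<open>min a c\<close> as an integral of a product of two indicator functions turns this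
  into the Cauchy-Schwarz inequality.\<close>

lemma sum_min_scale_le:
  fixes r w :: "'a \<Rightarrow> real"
  assumes "finite A" "\<And>j. j \<in> A \<Longrightarrow> 0 \<le> r j" "0 < l"
  shows "(\<Sum>j\<in>A. \<Sum>k\<in>A. w j * w k * (min (r j) (l * r k) + min (l * r j) (r k)))
     \<le> 2 * sqrt l * (\<Sum>j\<in>A. \<Sum>k\<in>A. w j * w k * min (r j) (r k))"
proof -
  define f :: "real \<Rightarrow> real \<Rightarrow> real" where "f a = indicator {0..a}" for a
  define B where "B = Max (insert 0 (r ` A \<union> (\<lambda>j. l * r j) ` A))"
  have B: "r j \<le> B" "l * r j \<le> B" if "j \<in> A" for j
    using that assms(1) by (auto simp: B_def intro!: Max_ge)
  have f: "((\<lambda>x. f a x * f c x) has_integral min a c) {0..B}"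
    if "0 \<le> a" "0 \<le> c" "a \<le> B" for a c
  proof -
    have "((\<lambda>x. 1) has_integral min a c) {0..min a c}"
      using has_integral_const_real[of "1::real" 0 "min a c"] that by simp
    then have "((\<lambda>x. if x \<in> {0..min a c} then 1 else 0) has_integral min a c) {0..B}"
      using that by (subst has_integral_restrict) auto
    then show ?thesis
      by (rule has_integral_eq[rotated]) (auto simp: f_def indicator_def)
  qed
  have sqrt_l: "sqrt l * (sqrt l * z) = l * z" "sqrt l * (2 * sqrt l * z) = 2 * l * z" for z
    using assms(3) by (simp_all flip: mult.assoc)
  \<comment> \<open>With \<open>F\<close> and \<open>G\<close> the weighted sums of the indicators
    \<open>f (r j)\<close> and \<open>f (l * r j)\<close>, the integrals of \<open>F^2\<close> and
    \<open>G^2\<close> are \<open>Q\<close> and \<open>l * Q\<close>, where \<open>Q\<close> is the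
    double sum on the right. The factor \<open>sqrt l\<close> balances them, so that nonnegativity
    of the integral of \<open>(sqrt l * F - G)^2\<close> is exactly the Cauchy-Schwarz bound for the
    mixed term.\<close>
  define g where "g x = (\<Sum>j\<in>A. w j * (sqrt l * f (r j) x - f (l * r j) x))" for x
  define T where "T j k = l * min (r j) (r k) - sqrt l * (min (r j) (l * r k) + min (l * r j) (r k))
     + min (l * r j) (l * r k)" for j k
  have "((\<lambda>x. \<Sum>j\<in>A. \<Sum>k\<in>A. w j * w k *
      (l * (f (r j) x * f (r k) x) - sqrt l * (f (r j) x * f (l * r k) x + f (l * r j) x * f (r k) x)
       + f (l * r j) x * f (l * r k) x))
    has_integral (\<Sum>j\<in>A. \<Sum>k\<in>A. w j * w k * T j k)) {0..B}"
    unfolding T_def using assms B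
    by (intro has_integral_sum has_integral_mult_right has_integral_add has_integral_diff f) auto
  moreover have "(g x)\<^sup>2 = (\<Sum>j\<in>A. \<Sum>k\<in>A. w j * w k *
      (l * (f (r j) x * f (r k) x) - sqrt l * (f (r j) x * f (l * r k) x + f (l * r j) x * f (r k) x)
       + f (l * r j) x * f (l * r k) x))" for x
  proof -
    show ?thesis
      unfolding g_def power2_eq_square sum_product
      by (intro sum.cong refl) (simp add: algebra_simps sqrt_l)
  qed
  ultimately have "((\<lambda>x. (g x)\<^sup>2) has_integral (\<Sum>j\<in>A. \<Sum>k\<in>A. w j * w k * T j k)) {0..B}"
    by simp
  then have nonneg: "0 \<le> (\<Sum>j\<in>A. \<Sum>k\<in>A. w j * w k * T j k)"
    by (rule has_integral_nonneg) simp
  have "min (l * x) (l * y) = l * min x y" for x y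
    using assms(3) by (simp add: min_mult_distrib_left)
  then have T: "T j k = sqrt l * (2 * sqrt l * min (r j) (r k)
      - (min (r j) (l * r k) + min (l * r j) (r k)))" for j k
    by (simp add: T_def right_diff_distrib sqrt_l)
  have "(\<Sum>j\<in>A. \<Sum>k\<in>A. w j * w k * T j k) = sqrt l *
     (2 * sqrt l * (\<Sum>j\<in>A. \<Sum>k\<in>A. w j * w k * min (r j) (r k))
      - (\<Sum>j\<in>A. \<Sum>k\<in>A. w j * w k * (min (r j) (l * r k) + min (l * r j) (r k))))"
    unfolding T sum_distrib_left sum_subtractf[symmetric]
    by (intro sum.cong refl) (simp add: algebra_simps)
  with nonneg assms(3) show ?thesis by (simp add: zero_le_mult_iff)
qed

section \<open>Completion times\<close>

definition visit :: "(nat \<Rightarrow> real) \<Rightarrow> (nat \<Rightarrow> real) \<Rightarrow> real \<Rightarrow> nat \<Rightarrow> kr_state \<Rightarrow> kr_state" where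
  "visit p w x j s = (if j \<in> dom (snd s) then s else probe p j (w j * x) s)"

lemma scaling_round_visit:
  "scaling_round b \<sigma> \<xi> p w q = fold (visit p w (b powr (real_of_int q + \<xi>))) \<sigma>"
proof -
  have "visit p w x = (\<lambda>j s. if j \<in> dom (snd s) then s else probe p j (w j * x) s)" for x
    by (intro ext) (simp add: visit_def)
  then show ?thesis by (simp add: scaling_round_def)
qed

lemma fst_visit:
  "fst (visit p w x j s) = fst s + (if j \<in> dom (snd s) then 0 else min (p j) (w j * x))"
  by (cases s) (auto simp: visit_def)

lemma snd_visit:
  "snd (visit p w x j s) =
     (if j \<notin> dom (snd s) \<and> p j \<le> w j * x then (snd s)(j \<mapsto> fst s + p j) else snd s)"
  by (cases s) (auto simp: visit_def)

lemma snd_fold_visit_Some: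
  "snd s j = Some c \<Longrightarrow> snd (fold (visit p w x) js s) j = Some c"
proof (induction js arbitrary: s)
  case (Cons k js)
  from Cons.prems have "snd (visit p w x k s) j = Some c" by (auto simp: snd_visit)
  then show ?case using Cons.IH by simp
qed simp

lemma snd_fold_visit_notin:
  "j \<notin> set js \<Longrightarrow> snd (fold (visit p w x) js s) j = snd s j"
  by (induction js arbitrary: s) (auto simp: snd_visit)

lemma dom_fold_visit:
  "dom (snd (fold (visit p w x) js s)) = dom (snd s) \<union> {k \<in> set js. p k \<le> w k * x}"
  by (induction js arbitrary: s) (auto simp: snd_visit split: if_splits)

lemma fst_fold_visit:
  "distinct js \<Longrightarrow> fst (fold (visit p w x) js s) =
     fst s + (\<Sum>k\<in>set js - dom (snd s). min (p k) (w k * x))"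
proof (induction js arbitrary: s)
  case (Cons j js)
  have "set js - dom (snd (visit p w x j s)) = set js - dom (snd s)"
    using Cons.prems by (auto simp: snd_visit split: if_splits)
  then have "fst (fold (visit p w x) (j # js) s) =
      fst (visit p w x j s) + (\<Sum>k\<in>set js - dom (snd s). min (p k) (w k * x))"
    using Cons by simp
  then show ?case
    using Cons.prems by (auto simp: fst_visit insert_Diff_if)
qed simp

lemma snd_fold_visit_split:
  assumes "distinct (as @ j # bs)" "j \<notin> dom (snd s)" "p j \<le> w j * x"
  shows "snd (fold (visit p w x) (as @ j # bs) s) j =
    Some (fst s + (\<Sum>k\<in>set as - dom (snd s). min (p k) (w k * x)) + p j)"
proof -
  define s' where "s' = fold (visit p w x) as s"
  have "j \<notin> dom (snd s')"
    using assms by (auto simp: s'_def snd_fold_visit_notin)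
  then have "snd (visit p w x j s') j = Some (fst s' + p j)"
    using assms by (simp add: snd_visit)
  then have "snd (fold (visit p w x) (as @ j # bs) s) j = Some (fst s' + p j)"
    using assms by (simp add: snd_fold_visit_notin s'_def)
  then show ?thesis
    using assms by (simp add: s'_def fst_fold_visit)
qed

lemma snd_fold_round_Some:
  "snd s j = Some c \<Longrightarrow> snd (fold (scaling_round b \<sigma> \<xi> p w) qs s) j = Some c"
  by (induction qs arbitrary: s) (auto simp: scaling_round_visit snd_fold_visit_Some)

lemma scaling_run_Suc:
  "q0 \<le> m \<Longrightarrow> scaling_run b \<sigma> \<xi> p w q0 m =
     scaling_round b \<sigma> \<xi> p w m (scaling_run b \<sigma> \<xi> p w q0 (m - 1))"
  by (simp add: scaling_run_def upto_rec2)

lemma scaling_run_Some_mono: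
  assumes "snd (scaling_run b \<sigma> \<xi> p w q0 q) j = Some c" "q \<le> q'"
  shows "snd (scaling_run b \<sigma> \<xi> p w q0 q') j = Some c"
proof (cases "q0 \<le> q")
  case True
  then have "[q0..q'] = [q0..q] @ [q + 1..q']"
    using assms(2) by (intro upto_split2) auto
  then show ?thesis using assms(1) by (simp add: scaling_run_def snd_fold_round_Some)
next
  case False
  then show ?thesis using assms(1) by (simp add: scaling_run_def)
qed

lemma completion_from_eqI:
  assumes "snd (scaling_run b \<sigma> \<xi> p w q0 q) j = Some c"
  shows "completion_from b \<sigma> \<xi> p w q0 j = c"
  unfolding completion_from_def
proof (rule the_equality)
  show "\<exists>q1. snd (scaling_run b \<sigma> \<xi> p w q0 q1) j = Some c" using assms by blast
next
  fix c' assume "\<exists>q1. snd (scaling_run b \<sigma> \<xi> p w q0 q1) j = Some c'"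
  then obtain q' where "snd (scaling_run b \<sigma> \<xi> p w q0 q') j = Some c'" ..
  then have "snd (scaling_run b \<sigma> \<xi> p w q0 (max q q')) j = Some c'"
    by (rule scaling_run_Some_mono) simp
  moreover have "snd (scaling_run b \<sigma> \<xi> p w q0 (max q q')) j = Some c"
    using assms by (rule scaling_run_Some_mono) simp
  ultimately show "c' = c" by simp
qed

definition before :: "'a list \<Rightarrow> 'a \<Rightarrow> 'a set" where
  "before xs x = set (takeWhile (\<lambda>y. y \<noteq> x) xs)"

lemma before_append: "x \<notin> set as \<Longrightarrow> before (as @ x # bs) x = set as"
  by (auto simp: before_def takeWhile_append)

text \<open>This is why an order is paired with its reverse: every other job precedes
  \<open>x\<close> in exactly one of the two.\<close>

lemma before_partition:
  assumes "distinct xs" "x \<in> set xs"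
  shows "before xs x \<inter> before (rev xs) x = {}" "before xs x \<union> before (rev xs) x = set xs - {x}"
proof -
  obtain as bs where "xs = as @ x # bs" using split_list[OF assms(2)] by blast
  then show "before xs x \<inter> before (rev xs) x = {}"
     "before xs x \<union> before (rev xs) x = set xs - {x}"
    using assms by (auto simp: before_append)
qed

locale scaling_instance =
  fixes b :: real and n :: nat and p w :: "nat \<Rightarrow> real"
  assumes b: "1 < b" and ok: "instance_ok n p w"
begin

lemma pos: "j < n \<Longrightarrow> 0 < p j" "j < n \<Longrightarrow> 0 < w j"
  using ok by (auto simp: instance_ok_def)

definition scale :: "real \<Rightarrow> int \<Rightarrow> real" where
  "scale \<xi> q = b powr (real_of_int q + \<xi>)"

text \<open>The first round whose probing is long enough for \<open>j\<close>, hence the round in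
  which \<open>j\<close> completes if the run does not start later. It depends neither on the order
  nor on the other jobs, so the order influences \<open>j\<close> only inside this round.\<close>

definition level :: "real \<Rightarrow> nat \<Rightarrow> int" where
  "level \<xi> j = \<lceil>log b (p j / w j) - \<xi>\<rceil>"

lemma scale_Suc: "scale \<xi> (q + 1) = b * scale \<xi> q"
  using b by (simp add: scale_def powr_add)

lemma scale_mono: "q \<le> q' \<Longrightarrow> scale \<xi> q \<le> scale \<xi> q'"
  using b by (simp add: scale_def)

lemma level_le_iff:
  assumes "j < n" shows "level \<xi> j \<le> q \<longleftrightarrow> p j \<le> w j * scale \<xi> q"
proof -
  have "level \<xi> j \<le> q \<longleftrightarrow> log b (p j / w j) \<le> real_of_int q + \<xi>"
    by (simp add: level_def ceiling_le_iff algebra_simps)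
  also have "\<dots> \<longleftrightarrow> p j / w j \<le> scale \<xi> q"
    unfolding scale_def using b pos[OF assms] by (intro log_le_iff) auto
  finally show ?thesis using pos[OF assms] by (simp add: field_simps)
qed

context
  fixes \<sigma> :: "nat list" and \<xi> :: real and q0 :: int
  assumes perm: "\<sigma> \<in> permutations_of_set {..<n}"
      and start: "\<And>k. k < n \<Longrightarrow> q0 \<le> level \<xi> k"
begin

lemma set_order: "set \<sigma> = {..<n}" "distinct \<sigma>"
  using perm by (auto simp: permutations_of_set_def)

text \<open>The quotient by \<open>b - 1\<close> is the geometric sum of the aborted probings of
  \<open>k\<close> in the rounds from \<open>q0\<close> up to, but excluding,
  \<open>min (level \<xi> k) m\<close>. The state is the one before round \<open>m\<close>, so that
  \<open>m = q0\<close> is the empty run. Since \<open>q0\<close> is at most every level, no aborted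
  sum is negative.\<close>

lemma scaling_run_closed:
  assumes "q0 \<le> m"
  shows "dom (snd (scaling_run b \<sigma> \<xi> p w q0 (m - 1))) = {k. k < n \<and> level \<xi> k < m}"
    and "fst (scaling_run b \<sigma> \<xi> p w q0 (m - 1)) =
      (\<Sum>k<n. w k * (scale \<xi> (min (level \<xi> k) m) - scale \<xi> q0) / (b - 1) +
        (if level \<xi> k < m then p k else 0))"
  using assms
proof (induction m rule: int_ge_induct)
  case base
  have "min (level \<xi> k) q0 = q0 \<and> \<not> level \<xi> k < q0" if "k < n" for k
    using start[OF that] by auto
  then show "dom (snd (scaling_run b \<sigma> \<xi> p w q0 (q0 - 1))) = {k. k < n \<and> level \<xi> k < q0}"
    "fst (scaling_run b \<sigma> \<xi> p w q0 (q0 - 1)) =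
      (\<Sum>k<n. w k * (scale \<xi> (min (level \<xi> k) q0) - scale \<xi> q0) / (b - 1) +
        (if level \<xi> k < q0 then p k else 0))"
    by (auto simp: scaling_run_def)
next
  case (step m)
  define s where "s = scaling_run b \<sigma> \<xi> p w q0 (m - 1)"
  have dom: "dom (snd s) = {k. k < n \<and> level \<xi> k < m}"
    unfolding s_def using step.IH(1) .
  have s': "scaling_run b \<sigma> \<xi> p w q0 (m + 1 - 1) = fold (visit p w (scale \<xi> m)) \<sigma> s"
    using step.hyps by (simp add: scaling_run_Suc scaling_round_visit s_def scale_def)
  show "dom (snd (scaling_run b \<sigma> \<xi> p w q0 (m + 1 - 1))) = {k. k < n \<and> level \<xi> k < m + 1}"
    unfolding s' dom_fold_visit dom set_order by (auto simp flip: level_le_iff)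
  have "fst (scaling_run b \<sigma> \<xi> p w q0 (m + 1 - 1)) =
      fst s + (\<Sum>k\<in>{..<n} - {k. k < n \<and> level \<xi> k < m}. min (p k) (w k * scale \<xi> m))"
    unfolding s' by (simp add: fst_fold_visit set_order dom)
  also have "(\<Sum>k\<in>{..<n} - {k. k < n \<and> level \<xi> k < m}. min (p k) (w k * scale \<xi> m)) =
      (\<Sum>k<n. if level \<xi> k < m then 0 else min (p k) (w k * scale \<xi> m))"
    by (intro sum.mono_neutral_cong_left) auto
  also have "fst s + \<dots> = (\<Sum>k<n. w k * (scale \<xi> (min (level \<xi> k) (m + 1)) - scale \<xi> q0) / (b - 1) +
        (if level \<xi> k < m + 1 then p k else 0))"
    unfolding s_def step.IH(2) sum.distrib[symmetric]
  proof (intro sum.cong refl)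
    fix k assume "k \<in> {..<n}"
    then have k: "k < n" by simp
    consider "level \<xi> k < m" | "level \<xi> k = m" | "m < level \<xi> k" by linarith
    then show "w k * (scale \<xi> (min (level \<xi> k) m) - scale \<xi> q0) / (b - 1) +
         (if level \<xi> k < m then p k else 0) +
         (if level \<xi> k < m then 0 else min (p k) (w k * scale \<xi> m)) =
         w k * (scale \<xi> (min (level \<xi> k) (m + 1)) - scale \<xi> q0) / (b - 1) +
         (if level \<xi> k < m + 1 then p k else 0)"
    proof cases
      case 2
      then show ?thesis using level_le_iff[OF k, of \<xi> m] by simp
    next
      case 3
      then have "w k * scale \<xi> m < p k" using level_le_iff[OF k, of \<xi> m] by simp
      moreover have "min (level \<xi> k) m = m" "min (level \<xi> k) (m + 1) = m + 1" using 3 by auto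
      ultimately show ?thesis using 3 b scale_Suc[of \<xi> m] by (simp add: field_simps)
    qed simp
  qed
  finally show "fst (scaling_run b \<sigma> \<xi> p w q0 (m + 1 - 1)) =
    (\<Sum>k<n. w k * (scale \<xi> (min (level \<xi> k) (m + 1)) - scale \<xi> q0) / (b - 1) +
        (if level \<xi> k < m + 1 then p k else 0))" .
qed

text \<open>The first sum is the time at which the own round of \<open>j\<close> starts, the second
  the time that this round spends on jobs ahead of \<open>j\<close>.\<close>

lemma completion_from_closed:
  assumes j: "j < n"
  shows "completion_from b \<sigma> \<xi> p w q0 j =
    (\<Sum>k<n. w k * (scale \<xi> (min (level \<xi> k) (level \<xi> j)) - scale \<xi> q0) / (b - 1) +
        (if level \<xi> k < level \<xi> j then p k else 0)) +
    (\<Sum>k\<in>before \<sigma> j. if level \<xi> k < level \<xi> j then 0 else min (p k) (w k * scale \<xi> (level \<xi> j)))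
    + p j"
proof (rule completion_from_eqI)
  define m where "m = level \<xi> j"
  have m: "q0 \<le> m" using start[OF j] by (simp add: m_def)
  define s where "s = scaling_run b \<sigma> \<xi> p w q0 (m - 1)"
  have "j \<in> set \<sigma>" using j by (simp add: set_order)
  then obtain as bs where \<sigma>: "\<sigma> = as @ j # bs" using split_list by metis
  have d: "distinct (as @ j # bs)" using set_order(2) \<sigma> by simp
  have as: "before \<sigma> j = set as" using d \<sigma> by (simp add: before_append)
  have sub: "set as \<subseteq> {..<n}" using set_order(1) \<sigma> by auto
  have dom: "dom (snd s) = {k. k < n \<and> level \<xi> k < m}"
    unfolding s_def using scaling_run_closed(1)[OF m] .
  have "snd (scaling_run b \<sigma> \<xi> p w q0 m) j =
      snd (fold (visit p w (scale \<xi> m)) (as @ j # bs) s) j"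
    using m by (simp add: scaling_run_Suc scaling_round_visit s_def scale_def \<sigma>)
  also have "\<dots> = Some (fst s + (\<Sum>k\<in>set as - dom (snd s). min (p k) (w k * scale \<xi> m)) + p j)"
    using j by (intro snd_fold_visit_split d) (auto simp: dom m_def simp flip: level_le_iff)
  also have "(\<Sum>k\<in>set as - dom (snd s). min (p k) (w k * scale \<xi> m)) =
      (\<Sum>k\<in>before \<sigma> j. if level \<xi> k < m then 0 else min (p k) (w k * scale \<xi> m))"
    unfolding as dom using sub by (intro sum.mono_neutral_cong_left) auto
  finally show "snd (scaling_run b \<sigma> \<xi> p w q0 (level \<xi> j)) j = Some (
     (\<Sum>k<n. w k * (scale \<xi> (min (level \<xi> k) (level \<xi> j)) - scale \<xi> q0) / (b - 1) +
        (if level \<xi> k < level \<xi> j then p k else 0)) +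
    (\<Sum>k\<in>before \<sigma> j. if level \<xi> k < level \<xi> j then 0 else min (p k) (w k * scale \<xi> (level \<xi> j)))
    + p j)"
    using scaling_run_closed(2)[OF m] by (simp only: s_def m_def)
qed

end

lemma scale_tendsto_0: "((\<lambda>q. scale \<xi> q) \<longlongrightarrow> 0) at_bot"
proof -
  have "filterlim (\<lambda>q::int. real_of_int q + \<xi>) at_bot at_bot"
  proof (subst filterlim_at_bot, intro allI)
    fix Z :: real
    have "eventually (\<lambda>q::int. q \<le> \<lfloor>Z - \<xi>\<rfloor>) at_bot" by (rule eventually_le_at_bot)
    then show "eventually (\<lambda>q::int. real_of_int q + \<xi> \<le> Z) at_bot"
      by eventually_elim (simp add: le_floor_iff algebra_simps)
  qed
  moreover have "((\<lambda>x. b powr x) \<longlongrightarrow> 0) at_bot"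
    using b by real_asymp
  ultimately show ?thesis unfolding scale_def by (rule filterlim_compose[rotated])
qed

text \<open>Once \<open>q0\<close> is below all levels, the closed form depends on \<open>q0\<close>
  only through \<open>scale \<xi> q0\<close>, which tends to 0.\<close>

lemma scaling_completion_closed:
  assumes perm: "\<sigma> \<in> permutations_of_set {..<n}" and j: "j < n"
  shows "scaling_completion b \<sigma> \<xi> p w j =
    (\<Sum>k<n. w k * scale \<xi> (min (level \<xi> k) (level \<xi> j)) / (b - 1) +
        (if level \<xi> k < level \<xi> j then p k else 0)) +
    (\<Sum>k\<in>before \<sigma> j. if level \<xi> k < level \<xi> j then 0 else min (p k) (w k * scale \<xi> (level \<xi> j)))
    + p j"
  unfolding scaling_completion_def
proof (rule tendsto_Lim)
  show "\<not> trivial_limit (at_bot :: int filter)" by simp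
  define l where "l = Min (level \<xi> ` {..<n})"
  have "eventually (\<lambda>q0::int. q0 \<le> l) at_bot" by (rule eventually_le_at_bot)
  then have ev: "eventually (\<lambda>q0.
    (\<Sum>k<n. w k * (scale \<xi> (min (level \<xi> k) (level \<xi> j)) - scale \<xi> q0) / (b - 1) +
        (if level \<xi> k < level \<xi> j then p k else 0)) +
    (\<Sum>k\<in>before \<sigma> j. if level \<xi> k < level \<xi> j then 0 else min (p k) (w k * scale \<xi> (level \<xi> j)))
    + p j = completion_from b \<sigma> \<xi> p w q0 j) at_bot"
  proof eventually_elim
    case (elim q0)
    have "q0 \<le> level \<xi> k" if "k < n" for k
    proof -
      have "l \<le> level \<xi> k" unfolding l_def using that by (intro Min_le) auto
      with elim show ?thesis by simp
    qed
    from completion_from_closed[OF perm this j] show ?case by simp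
  qed
  show "((\<lambda>q0. completion_from b \<sigma> \<xi> p w q0 j) \<longlongrightarrow>
    (\<Sum>k<n. w k * scale \<xi> (min (level \<xi> k) (level \<xi> j)) / (b - 1) +
        (if level \<xi> k < level \<xi> j then p k else 0)) +
    (\<Sum>k\<in>before \<sigma> j. if level \<xi> k < level \<xi> j then 0 else min (p k) (w k * scale \<xi> (level \<xi> j)))
    + p j) at_bot"
    using b by (intro Lim_transform_eventually[OF _ ev]) (auto intro!: tendsto_eq_intros scale_tendsto_0)
qed

end

section \<open>Averaging over the offset\<close>

text \<open>The map \<open>x \<mapsto> \<lceil>a - x\<rceil> + x - a\<close> rotates the unit
  interval, up to finitely many points: with \<open>d = frac a\<close> it shifts
  \<open>{0..d}\<close> by \<open>1 - d\<close> and \<open>{d..1}\<close> by \<open>- d\<close>.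
  Hence the exponent by which a ratio is rounded up is again uniform, whatever the ratio.\<close>

lemma has_integral_ceiling_rotate:
  fixes f :: "real \<Rightarrow> 'a::banach"
  assumes "(f has_integral I) {0..1}"
  shows "((\<lambda>x. f (of_int \<lceil>a - x\<rceil> + x - a)) has_integral I) {0..1}"
proof -
  define d where "d = frac a"
  have d: "0 \<le> d" "d < 1" by (simp_all add: d_def frac_lt_1)
  have a: "a = of_int \<lfloor>a\<rfloor> + d" by (simp add: d_def frac_def)
  have f1: "(f has_integral integral {0..1 - d} f) {0..1 - d}"
    and f2: "(f has_integral integral {1 - d..1} f) {1 - d..1}"
    using d integrable_subinterval_real[OF has_integral_integrable[OF assms]]
    by (auto intro!: integrable_integral)
  have "I = integral {0..1 - d} f + integral {1 - d..1} f"
    using has_integral_combine[OF _ _ f1 f2] d assms by (auto dest: has_integral_unique)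
  moreover have "((\<lambda>x. f (of_int \<lceil>a - x\<rceil> + x - a)) has_integral integral {1 - d..1} f) {0..d}"
  proof (rule has_integral_spike_finite[of "{d}"])
    show "((\<lambda>x. f (x + (1 - d))) has_integral integral {1 - d..1} f) {0..d}"
      using has_integral_affinity'[of f _ "1 - d" 1 1 "1 - d"] f2 by simp
    fix x assume x: "x \<in> {0..d} - {d}"
    then have "\<lceil>a - x\<rceil> = \<lfloor>a\<rfloor> + 1"
      using d a by (intro ceiling_unique) auto
    then show "f (of_int \<lceil>a - x\<rceil> + x - a) = f (x + (1 - d))"
      using a by (intro arg_cong[of _ _ f]) simp
  qed simp
  moreover have "((\<lambda>x. f (of_int \<lceil>a - x\<rceil> + x - a)) has_integral integral {0..1 - d} f) {d..1}"
  proof (rule has_integral_spike_finite[of "{1}"])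
    show "((\<lambda>x. f (x + (- d))) has_integral integral {0..1 - d} f) {d..1}"
      using has_integral_affinity'[of f _ 0 "1 - d" 1 "- d"] f1 by simp
    fix x assume x: "x \<in> {d..1} - {1}"
    then have "\<lceil>a - x\<rceil> = \<lfloor>a\<rfloor>"
      using d a by (intro ceiling_unique) auto
    then show "f (of_int \<lceil>a - x\<rceil> + x - a) = f (x + (- d))"
      using a by (intro arg_cong[of _ _ f]) simp
  qed simp
  ultimately show ?thesis
    using d has_integral_combine[of 0 d 1 "\<lambda>x. f (of_int \<lceil>a - x\<rceil> + x - a)"
        "integral {1 - d..1} f" "integral {0..1 - d} f"]
    by (simp add: add.commute)
qed

lemma has_integral_powr:
  assumes "1 < (b::real)" "c \<noteq> 0" "s \<le> t"
  shows "((\<lambda>u. b powr (c * u)) has_integral (b powr (c * t) - b powr (c * s)) / (c * ln b)) {s..t}"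
proof -
  have "((\<lambda>u. b powr (c * u)) has_integral
    b powr (c * t) / (c * ln b) - b powr (c * s) / (c * ln b)) {s..t}"
  proof (intro fundamental_theorem_of_calculus assms)
    fix u
    show "((\<lambda>u. b powr (c * u) / (c * ln b)) has_vector_derivative b powr (c * u))
       (at u within {s..t})"
      unfolding has_real_derivative_iff_has_vector_derivative[symmetric]
      using assms by (auto intro!: derivative_eq_intros simp: powr_def)
  qed
  then show ?thesis by (simp add: diff_divide_distrib)
qed

text \<open>The least number of the form \<open>b powr (q + \<xi>)\<close> with integer
  \<open>q\<close> that is at least \<open>x\<close>. At \<open>x = p j / w j\<close> it is the
  scale of the round that completes \<open>j\<close>.\<close>

definition rounded :: "real \<Rightarrow> real \<Rightarrow> real \<Rightarrow> real" where
  "rounded b \<xi> x = b powr (of_int \<lceil>log b x - \<xi>\<rceil> + \<xi>)"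

lemma rounded_eq:
  assumes "1 < b" "0 < x"
  shows "rounded b \<xi> x = x * b powr (of_int \<lceil>log b x - \<xi>\<rceil> + \<xi> - log b x)"
  using assms by (simp add: rounded_def powr_diff)

lemma rounded_ge:
  assumes "1 < b" "0 < x" shows "x \<le> rounded b \<xi> x"
proof -
  have "log b x \<le> of_int \<lceil>log b x - \<xi>\<rceil> + \<xi>" by linarith
  then show ?thesis using assms by (simp add: rounded_def log_le_iff)
qed

lemma rounded_le:
  assumes "1 < b" "0 < x" shows "rounded b \<xi> x \<le> b * x"
proof -
  have "of_int \<lceil>log b x - \<xi>\<rceil> + \<xi> \<le> 1 + log b x" by linarith
  then have "rounded b \<xi> x \<le> b powr (1 + log b x)" using assms by (simp add: rounded_def)
  then show ?thesis using assms by (simp add: powr_add)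
qed

lemma rounded_mono:
  assumes "1 < b" "0 < x" "x \<le> y" shows "rounded b \<xi> x \<le> rounded b \<xi> y"
proof -
  have "\<lceil>log b x - \<xi>\<rceil> \<le> \<lceil>log b y - \<xi>\<rceil>" using assms by (intro ceiling_mono) simp
  then show ?thesis using assms by (simp add: rounded_def)
qed

text \<open>As \<open>rounded b \<xi> x\<close> is itself a grid point, rounding \<open>y\<close> up
  passes it exactly if \<open>y\<close> does. Thus the rounding of the smaller ratio alone decides
  whether two jobs share their final round, and one uniform variable suffices for a pair.\<close>

lemma rounded_less_iff:
  assumes "1 < b" "0 < x" "x \<le> y"
  shows "rounded b \<xi> x < rounded b \<xi> y \<longleftrightarrow> rounded b \<xi> x < y"
proof
  assume "rounded b \<xi> x < y"
  also have "y \<le> rounded b \<xi> y" using assms by (intro rounded_ge) auto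
  finally show "rounded b \<xi> x < rounded b \<xi> y" .
next
  assume "rounded b \<xi> x < rounded b \<xi> y"
  then have "\<lceil>log b x - \<xi>\<rceil> < \<lceil>log b y - \<xi>\<rceil>"
    using assms by (simp add: rounded_def)
  then have "of_int \<lceil>log b x - \<xi>\<rceil> + \<xi> < log b y" by linarith
  then show "rounded b \<xi> x < y" using assms by (simp add: rounded_def less_log_iff)
qed

text \<open>The time spent on job \<open>k\<close> before completion of job \<open>j\<close>, divided by the weight of \<open>k\<close> and
  added up over an order and its reverse, where \<open>x\<close> and \<open>y\<close> stand for \<open>p j / w j\<close> and
  \<open>p k / w k\<close>. For \<open>j = k\<close> it misses one of the two successful probings.\<close>

definition delay :: "real \<Rightarrow> real \<Rightarrow> real \<Rightarrow> real \<Rightarrow> real" where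
  "delay b \<xi> x y = 2 * min (rounded b \<xi> y) (rounded b \<xi> x) / (b - 1) +
     (if rounded b \<xi> y < rounded b \<xi> x then 2 * y else min y (rounded b \<xi> x))"

definition shifted_min :: "real \<Rightarrow> real \<Rightarrow> real \<Rightarrow> real" where
  "shifted_min x y l = min x (l * y) + min (l * x) y"

lemma delay_sym:
  assumes b: "1 < (b::real)" and xy: "0 < x" "x \<le> y"
  shows "delay b \<xi> x y + delay b \<xi> y x =
    4 * rounded b \<xi> x / (b - 1) + (if rounded b \<xi> x < y then rounded b \<xi> x + 2 * x else x + y)"
proof -
  have "rounded b \<xi> x \<le> rounded b \<xi> y" "x \<le> rounded b \<xi> x"
    using assms rounded_mono rounded_ge by auto
  then show ?thesis
    using rounded_less_iff[OF assms, of \<xi>] unfolding delay_def by auto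
qed

text \<open>The integrand vanishes until \<open>u\<close> reaches \<open>log b (y / x)\<close>,
  where \<open>y * b powr (- u)\<close> equals \<open>x\<close>; at \<open>u = 1\<close> it equals
  \<open>y / b\<close>. If \<open>b * x < y\<close>, this point lies beyond 1 and both sides are
  0.\<close>

lemma has_integral_threshold:
  assumes b: "1 < (b::real)" and xy: "0 < x" "x \<le> y"
  shows "((\<lambda>u. if x * b powr u < y then 0 else y * b powr (- u)) has_integral
     (x - min x (y / b)) / ln b) {0..1}"
proof (cases "y \<le> b * x")
  case True
  define d where "d = log b (y / x)"
  have "y / x \<le> b powr 1" "1 \<le> y / x" using xy b True by (simp_all add: field_simps)
  then have d: "0 \<le> d" "d \<le> 1" using b xy by (auto simp: d_def log_le_iff le_log_iff)
  have bd: "b powr d = y / x" using b xy by (simp add: d_def)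
  have iff: "x * b powr u < y \<longleftrightarrow> u < d" for u
  proof -
    have "x * b powr u < y \<longleftrightarrow> b powr u < b powr d" using xy by (simp add: bd field_simps)
    then show ?thesis using b by simp
  qed
  have "((\<lambda>u. y * b powr (- 1 * u)) has_integral
      y * ((b powr (- 1 * 1) - b powr (- 1 * d)) / (- 1 * ln b))) {d..1}"
    using b d by (intro has_integral_mult_right has_integral_powr) auto
  moreover have "y * ((b powr (- 1 * 1) - b powr (- 1 * d)) / (- 1 * ln b)) = (x - y / b) / ln b"
    using b xy bd by (simp add: powr_minus field_simps)
  ultimately have "((\<lambda>u. y * b powr (- u)) has_integral (x - y / b) / ln b) {d..1}"
    by simp
  then have "((\<lambda>u. if u \<in> {d..1} then y * b powr (- u) else 0) has_integral (x - y / b) / ln b) {0..1}"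
    using d by (subst has_integral_restrict) auto
  then have "((\<lambda>u. if x * b powr u < y then 0 else y * b powr (- u)) has_integral
      (x - y / b) / ln b) {0..1}"
    by (rule has_integral_eq[rotated]) (auto simp: iff)
  moreover have "min x (y / b) = y / b" using True b by (simp add: field_simps min_def)
  ultimately show ?thesis by simp
next
  case False
  have "((\<lambda>u. if x * b powr u < y then 0 else y * b powr (- u)) has_integral 0) {0..1}"
  proof (rule has_integral_eq)
    fix u :: real assume "u \<in> {0..1}"
    then have "b powr u \<le> b powr 1" using b by (intro powr_mono) auto
    then have "x * b powr u \<le> x * b" using b xy by simp
    then have "x * b powr u < y" using False by (simp add: mult.commute)
    then show "0 = (if x * b powr u < y then 0 else y * b powr (- u))" by simp
  qed simp
  moreover have "min x (y / b) = x" using False b by (simp add: field_simps min_def)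
  ultimately show ?thesis by simp
qed

text \<open>The doubled pair cost is split so that \<open>min x y\<close> and
  \<open>shifted_min x y l\<close> with \<open>1 \<le> l \<le> b\<close> appear with nonnegative
  coefficients only. The value \<open>J\<close> stays abstract because a useful bound exists only
  for its sum over all pairs.\<close>

lemma has_integral_delay_sym_aux:
  assumes b: "1 < (b::real)" and xy: "0 < x" "x \<le> y"
    and J: "((\<lambda>u. (1 + b powr (- u)) * shifted_min x y (b powr u)) has_integral J) {0..1}"
  shows "((\<lambda>\<xi>. delay b \<xi> x y + delay b \<xi> y x) has_integral
    2 * min x y / ln b + shifted_min x y b / (b * ln b) + J) {0..1}"
proof -
  define h where "h u = 4 * (x * b powr u) / (b - 1) +
    (if x * b powr u < y then x * b powr u + 2 * x else x + y)" for u
  have "((\<lambda>u. b powr (1 * u)) has_integral (b powr (1 * 1) - b powr (1 * 0)) / (1 * ln b)) {0..1}"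
    using b by (intro has_integral_powr) auto
  then have 1: "((\<lambda>u. b powr u) has_integral (b - 1) / ln b) {0..1}" using b by simp
  have "((\<lambda>u. b powr (- 1 * u)) has_integral
      (b powr (- 1 * 1) - b powr (- 1 * 0)) / (- 1 * ln b)) {0..1}"
    using b by (intro has_integral_powr) auto
  moreover have "(b powr (- 1 * 1) - b powr (- 1 * 0)) / (- 1 * ln b) = (1 - 1 / b) / ln b"
    using b by (simp add: powr_minus_divide field_simps)
  ultimately have 2: "((\<lambda>u. b powr (- u)) has_integral (1 - 1 / b) / ln b) {0..1}" by simp
  have int: "((\<lambda>u. (4 * x / (b - 1)) * b powr u - x * b powr (- u)
       - (if x * b powr u < y then 0 else y * b powr (- u))
       + (1 + b powr (- u)) * shifted_min x y (b powr u)) has_integral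
       (4 * x / (b - 1)) * ((b - 1) / ln b) - x * ((1 - 1 / b) / ln b) - (x - min x (y / b)) / ln b + J) {0..1}"
    by (intro has_integral_add has_integral_diff has_integral_mult_right has_integral_threshold 1 2 J assms)
  \<comment> \<open>Over \<open>ln b\<close>, the coefficients of \<open>x\<close> are 4, -1,
    \<open>1 / b\<close> and -1. The leftover \<open>x / b + min x (y / b)\<close> is
    \<open>shifted_min x y b / b\<close>, and \<open>2 * x\<close> remains.\<close>
  have val: "(4 * x / (b - 1)) * ((b - 1) / ln b) - x * ((1 - 1 / b) / ln b) - (x - min x (y / b)) / ln b
     = 2 * min x y / ln b + shifted_min x y b / (b * ln b)"
  proof -
    have "x \<le> b * y" using b xy by (intro order.trans[OF xy(2)]) simp
    then have m: "min x (b * y) = x" "min x y = x" using xy by auto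
    have m': "min x (y / b) = min (b * x) y / b" using b by (simp add: min_def field_simps)
    have "0 < ln b" using b by simp
    then show ?thesis
      unfolding shifted_min_def m m' using b by (simp add: field_simps)
  qed
  \<comment> \<open>With \<open>c = b powr u\<close>, the product
    \<open>(1 + 1 / c) * (x + min (c * x) y)\<close> is \<open>2 * x + c * x + x / c\<close> below
    the threshold and \<open>x + y + (x + y) / c\<close> above it. The subtracted terms remove
    exactly the parts with denominator \<open>c\<close>.\<close>
  have pointwise: "(4 * x / (b - 1)) * b powr u - x * b powr (- u)
       - (if x * b powr u < y then 0 else y * b powr (- u))
       + (1 + b powr (- u)) * shifted_min x y (b powr u) = h u" if "u \<in> {0..1}" for u
  proof -
    define c where "c = b powr u"
    have c: "1 \<le> c" using b that by (auto simp: c_def ge_one_powr_ge_zero)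
    have c': "b powr (- u) = 1 / c" by (simp add: c_def powr_minus_divide)
    have "x * 1 \<le> c * y" using c xy by (subst mult.commute, intro mult_mono) auto
    then show ?thesis
      unfolding h_def shifted_min_def c' c_def[symmetric] using c xy b
      by (auto simp: min_def mult.commute add_divide_distrib algebra_simps)
  qed
  have h: "(h has_integral
      2 * min x y / ln b + shifted_min x y b / (b * ln b) + J) {0..1}"
    using has_integral_eq[OF pointwise int] unfolding val .
  have "delay b \<xi> x y + delay b \<xi> y x = h (of_int \<lceil>log b x - \<xi>\<rceil> + \<xi> - log b x)" for \<xi>
    by (simp add: delay_sym assms h_def flip: rounded_eq)
  then show ?thesis
    using has_integral_ceiling_rotate[OF h, of "log b x"] by simp
qed

lemma shifted_min_commute: "shifted_min x y l = shifted_min y x l"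
  by (simp add: shifted_min_def min.commute add.commute)

lemma has_integral_delay_sym:
  assumes b: "1 < (b::real)" and xy: "0 < x" "0 < y"
    and J: "((\<lambda>u. (1 + b powr (- u)) * shifted_min x y (b powr u)) has_integral J) {0..1}"
  shows "((\<lambda>\<xi>. delay b \<xi> x y + delay b \<xi> y x) has_integral
    2 * min x y / ln b + shifted_min x y b / (b * ln b) + J) {0..1}"
proof (cases "x \<le> y")
  case True
  then show ?thesis using assms by (intro has_integral_delay_sym_aux)
next
  case False
  then have "((\<lambda>\<xi>. delay b \<xi> y x + delay b \<xi> x y) has_integral
    2 * min y x / ln b + shifted_min y x b / (b * ln b) + J) {0..1}"
    using assms by (intro has_integral_delay_sym_aux) (auto simp: shifted_min_commute[of y x])
  then show ?thesis by (simp add: shifted_min_commute[of y x] min.commute add.commute)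
qed

text \<open>Exchanging the summation indices replaces \<open>delay\<close> by its symmetrization,
  whose integral is known for each pair. The sums over all pairs are then bounded for each scale
  \<open>l\<close> separately, and the bounds are integrated.\<close>

lemma integral_delay_le:
  assumes b: "1 < (b::real)" and r: "finite A" "\<And>j. j \<in> A \<Longrightarrow> 0 < r j"
  obtains I where "((\<lambda>\<xi>. \<Sum>j\<in>A. \<Sum>k\<in>A. w j * w k * delay b \<xi> (r j) (r k)) has_integral I) {0..1}"
    and "I \<le> scaling_ratio b * (\<Sum>j\<in>A. \<Sum>k\<in>A. w j * w k * min (r j) (r k))"
proof -
  define Q where "Q = (\<Sum>j\<in>A. \<Sum>k\<in>A. w j * w k * min (r j) (r k))"
  define S where "S l = (\<Sum>j\<in>A. \<Sum>k\<in>A. w j * w k * shifted_min (r j) (r k) l)" for l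
  have S: "S l \<le> 2 * sqrt l * Q" if "0 < l" for l
    using sum_min_scale_le[of A r l w] r that by (simp add: S_def Q_def shifted_min_def less_imp_le)
  define J where "J x y = integral {0..1} (\<lambda>u. (1 + b powr (- u)) * shifted_min x y (b powr u))" for x y
  have J: "((\<lambda>u. (1 + b powr (- u)) * shifted_min x y (b powr u)) has_integral J x y) {0..1}" for x y
    unfolding J_def shifted_min_def using b
    by (intro integrable_integral integrable_continuous_real continuous_intros) auto
  define I where "I = (\<Sum>j\<in>A. \<Sum>k\<in>A. w j * w k *
     (2 * min (r j) (r k) / ln b + shifted_min (r j) (r k) b / (b * ln b) + J (r j) (r k))) / 2"
  have "((\<lambda>\<xi>. (\<Sum>j\<in>A. \<Sum>k\<in>A. w j * w k * (delay b \<xi> (r j) (r k) + delay b \<xi> (r k) (r j))) / 2)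
    has_integral I) {0..1}"
    unfolding I_def using r b
    by (intro has_integral_divide has_integral_sum has_integral_mult_right has_integral_delay_sym J) auto
  moreover have "(\<Sum>j\<in>A. \<Sum>k\<in>A. w j * w k * (delay b \<xi> (r j) (r k) + delay b \<xi> (r k) (r j))) / 2 =
    (\<Sum>j\<in>A. \<Sum>k\<in>A. w j * w k * delay b \<xi> (r j) (r k))" for \<xi>
  proof -
    have "(\<Sum>j\<in>A. \<Sum>k\<in>A. w j * w k * delay b \<xi> (r k) (r j)) =
        (\<Sum>j\<in>A. \<Sum>k\<in>A. w j * w k * delay b \<xi> (r j) (r k))"
      by (subst sum.swap) (intro sum.cong refl, simp)
    then show ?thesis by (simp add: distrib_left sum.distrib)
  qed
  ultimately have int: "((\<lambda>\<xi>. \<Sum>j\<in>A. \<Sum>k\<in>A. w j * w k * delay b \<xi> (r j) (r k)) has_integral I) {0..1}"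
    by simp
  \<comment> \<open>Summation is moved inside the integral so that the bound on \<open>S\<close>
    applies at each single \<open>u\<close>.\<close>
  have "((\<lambda>u. \<Sum>j\<in>A. \<Sum>k\<in>A. w j * w k * ((1 + b powr (- u)) * shifted_min (r j) (r k) (b powr u)))
    has_integral (\<Sum>j\<in>A. \<Sum>k\<in>A. w j * w k * J (r j) (r k))) {0..1}"
    using r by (intro has_integral_sum has_integral_mult_right J) auto
  then have Jsum: "((\<lambda>u. (1 + b powr (- u)) * S (b powr u))
    has_integral (\<Sum>j\<in>A. \<Sum>k\<in>A. w j * w k * J (r j) (r k))) {0..1}"
    by (simp add: S_def sum_distrib_left mult_ac)
  define s where "s = sqrt b"
  have s: "1 < s" "b = s * s" "ln b = 2 * ln s" "0 < ln s"
    using b by (auto simp: s_def ln_sqrt)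
  have half: "b powr (1 / 2) = s" "b powr (- 1 / 2) = 1 / s"
    using b by (simp_all add: s_def powr_half_sqrt powr_minus_divide)
  have "((\<lambda>u. b powr (1/2 * u)) has_integral (b powr (1/2 * 1) - b powr (1/2 * 0)) / (1/2 * ln b)) {0..1}"
    and "((\<lambda>u. b powr (- 1/2 * u)) has_integral (b powr (- 1/2 * 1) - b powr (- 1/2 * 0)) / (- 1/2 * ln b)) {0..1}"
    using b by (intro has_integral_powr; simp)+
  moreover have "(b powr (1/2 * 1) - b powr (1/2 * 0)) / (1/2 * ln b) = (s - 1) / ln s"
    "(b powr (- 1/2 * 1) - b powr (- 1/2 * 0)) / (- 1/2 * ln b) = (1 - 1 / s) / ln s"
    using b s(1,4) unfolding s(3) mult_1_right half by (simp_all add: field_simps)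
  ultimately have "((\<lambda>u. 2 * Q * (b powr (1/2 * u) + b powr (- 1/2 * u))) has_integral
     2 * Q * ((s - 1) / ln s + (1 - 1 / s) / ln s)) {0..1}"
    by (intro has_integral_mult_right has_integral_add) simp_all
  then have "(\<Sum>j\<in>A. \<Sum>k\<in>A. w j * w k * J (r j) (r k)) \<le> 2 * Q * ((s - 1) / ln s + (1 - 1 / s) / ln s)"
  proof (rule has_integral_le[OF Jsum])
    fix u :: real
    have "(1 + b powr (- u)) * S (b powr u) \<le> (1 + b powr (- u)) * (2 * sqrt (b powr u) * Q)"
      using b by (intro mult_left_mono S) (auto simp: add_nonneg_nonneg)
    also have "sqrt (b powr u) = b powr (1/2 * u)"
      using b by (simp add: powr_half_sqrt[symmetric] powr_powr mult.commute)
    also have "(1 + b powr (- u)) * (2 * b powr (1/2 * u) * Q) =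
       2 * Q * (b powr (1/2 * u) + b powr (- u) * b powr (1/2 * u))" by (simp add: algebra_simps)
    also have "b powr (- u) * b powr (1/2 * u) = b powr (- 1/2 * u)"
      by (simp flip: powr_add)
    finally show "(1 + b powr (- u)) * S (b powr u) \<le> 2 * Q * (b powr (1/2 * u) + b powr (- 1/2 * u))" .
  qed
  moreover have "2 * I = 2 * Q / ln b + S b / (b * ln b) + (\<Sum>j\<in>A. \<Sum>k\<in>A. w j * w k * J (r j) (r k))"
    by (simp add: I_def Q_def S_def distrib_left sum.distrib sum_distrib_left sum_divide_distrib mult_ac)
  moreover have "S b / (b * ln b) \<le> 2 * s * Q / (b * ln b)"
    using S[of b] b by (intro divide_right_mono) (auto simp: s_def)
  ultimately have "2 * I \<le> 2 * Q / ln b + 2 * s * Q / (b * ln b) + 2 * Q * ((s - 1) / ln s + (1 - 1 / s) / ln s)"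
    by linarith
  \<comment> \<open>Over the common denominator \<open>2 * ln s\<close>, the three contributions to
    the factor of \<open>Q\<close> are \<open>1\<close>, \<open>1 / s\<close> and
    \<open>2 * s - 2 / s\<close>, adding up to the numerator of \<open>root_ratio\<close>.\<close>
  also have "\<dots> = 2 * (scaling_ratio b * Q)"
    unfolding scaling_ratio_root[OF b] root_ratio_def s_def[symmetric] s(3)
    unfolding s(2) using s(1,4) by (simp add: field_simps)
  finally show ?thesis using int that by (simp add: Q_def)
qed

section \<open>Averaging over an order and its reverse\<close>

context scaling_instance
begin

lemma scale_level: "scale \<xi> (level \<xi> j) = rounded b \<xi> (p j / w j)"
  by (simp add: scale_def level_def rounded_def)

lemma scaling_completion_add_rev:
  assumes perm: "\<sigma> \<in> permutations_of_set {..<n}" and j: "j < n"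
  shows "scaling_completion b \<sigma> \<xi> p w j + scaling_completion b (rev \<sigma>) \<xi> p w j =
    (\<Sum>k<n. w k * delay b \<xi> (p j / w j) (p k / w k)) + p j"
proof -
  define base where "base k = w k * scale \<xi> (min (level \<xi> k) (level \<xi> j)) / (b - 1) +
    (if level \<xi> k < level \<xi> j then p k else 0)" for k
  define e where "e k = (if level \<xi> k < level \<xi> j then 0 else min (p k) (w k * scale \<xi> (level \<xi> j)))" for k
  have rev: "rev \<sigma> \<in> permutations_of_set {..<n}" and \<sigma>: "distinct \<sigma>" "set \<sigma> = {..<n}"
    using perm by (auto simp: permutations_of_set_def)
  have "scaling_completion b \<sigma> \<xi> p w j + scaling_completion b (rev \<sigma>) \<xi> p w j =
     2 * (\<Sum>k<n. base k) + ((\<Sum>k\<in>before \<sigma> j. e k) + (\<Sum>k\<in>before (rev \<sigma>) j. e k)) + 2 * p j"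
    by (simp add: scaling_completion_closed[OF perm j] scaling_completion_closed[OF rev j] base_def e_def)
  also have "(\<Sum>k\<in>before \<sigma> j. e k) + (\<Sum>k\<in>before (rev \<sigma>) j. e k) = (\<Sum>k\<in>{..<n} - {j}. e k)"
    using before_partition[OF \<sigma>(1), of j] j \<sigma>(2)
    by (subst sum.union_disjoint[symmetric]) (auto simp: before_def)
  \<comment> \<open>Extending the sum to \<open>k = j\<close> adds \<open>e j = p j\<close> and so
    absorbs one of the two successful probings of \<open>j\<close>. The other one is the
    \<open>p j\<close> left over in the statement.\<close>
  also have "\<dots> = (\<Sum>k<n. e k) - p j"
  proof -
    have "p j \<le> w j * scale \<xi> (level \<xi> j)" using level_le_iff[OF j, of \<xi> "level \<xi> j"] by simp
    then have "e j = p j" by (simp add: e_def)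
    then show ?thesis using j by (simp add: sum_diff1)
  qed
  also have "2 * (\<Sum>k<n. base k) + ((\<Sum>k<n. e k) - p j) + 2 * p j = (\<Sum>k<n. 2 * base k + e k) + p j"
    by (simp add: sum.distrib sum_distrib_left)
  also have "(\<Sum>k<n. 2 * base k + e k) = (\<Sum>k<n. w k * delay b \<xi> (p j / w j) (p k / w k))"
  proof (intro sum.cong refl)
    fix k assume "k \<in> {..<n}"
    then have w: "0 < w k" using pos by simp
    have less: "scale \<xi> q < scale \<xi> q' \<longleftrightarrow> q < q'" for q q' using b by (simp add: scale_def)
    have "scale \<xi> (min (level \<xi> k) (level \<xi> j)) = min (scale \<xi> (level \<xi> k)) (scale \<xi> (level \<xi> j))"
      using scale_mono by (simp add: min_def) (metis antisym linear)
    moreover have "w k * min (p k / w k) x = min (p k) (w k * x)" for x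
      using w by (simp add: min_mult_distrib_left)
    ultimately show "2 * base k + e k = w k * delay b \<xi> (p j / w j) (p k / w k)"
      using w by (simp add: base_def e_def delay_def distrib_left less flip: scale_level)
  qed
  finally show ?thesis .
qed

lemma scaling_cost_add_rev:
  assumes perm: "\<sigma> \<in> permutations_of_set {..<n}"
  shows "scaling_cost b n p w (\<sigma>, \<xi>) + scaling_cost b n p w (rev \<sigma>, \<xi>) =
    (\<Sum>j<n. \<Sum>k<n. w j * w k * delay b \<xi> (p j / w j) (p k / w k)) + (\<Sum>j<n. w j * p j)"
proof -
  have "w j * scaling_completion b \<sigma> \<xi> p w j + w j * scaling_completion b (rev \<sigma>) \<xi> p w j =
     (\<Sum>k<n. w j * w k * delay b \<xi> (p j / w j) (p k / w k)) + w j * p j" if "j < n" for j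
    unfolding distrib_left[symmetric] scaling_completion_add_rev[OF assms that]
    by (simp add: distrib_left sum_distrib_left mult.assoc)
  then show ?thesis
    by (simp add: scaling_cost_def flip: sum.distrib)
qed

lemma scaling_cost_nonneg:
  assumes perm: "\<sigma> \<in> permutations_of_set {..<n}"
  shows "0 \<le> scaling_cost b n p w (\<sigma>, \<xi>)"
proof -
  have "before \<sigma> j \<subseteq> {..<n}" for j
    using perm set_takeWhileD by (fastforce simp: before_def permutations_of_set_def)
  then have "0 \<le> scaling_completion b \<sigma> \<xi> p w j" if "j < n" for j
    unfolding scaling_completion_closed[OF perm that] using pos b that
    by (intro add_nonneg_nonneg sum_nonneg)
       (auto intro!: divide_nonneg_nonneg mult_nonneg_nonneg less_imp_le simp: scale_def subset_iff)
  then show ?thesis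
    using pos by (auto simp: scaling_cost_def intro!: sum_nonneg mult_nonneg_nonneg less_imp_le[OF pos(2)])
qed

text \<open>The costs of an order and its reverse are nonnegative, so a bound on their sum, uniform
  in the order and the offset, bounds each of them.\<close>

lemma scaling_cost_bounded:
  obtains B where "\<And>\<sigma> \<xi>. \<sigma> \<in> permutations_of_set {..<n} \<Longrightarrow> \<bar>scaling_cost b n p w (\<sigma>, \<xi>)\<bar> \<le> B"
proof
  fix \<sigma> \<xi> assume perm: "\<sigma> \<in> permutations_of_set {..<n}"
  have rev: "rev \<sigma> \<in> permutations_of_set {..<n}" using perm by (auto simp: permutations_of_set_def)
  define r where "r j = p j / w j" for j
  have r: "0 < r j" if "j < n" for j using pos[OF that] by (simp add: r_def)
  have "delay b \<xi> x y \<le> 2 * (b * x) / (b - 1) + 2 * y" if "0 < x" "0 < y" for x y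
  proof -
    have "2 * min (rounded b \<xi> y) (rounded b \<xi> x) / (b - 1) \<le> 2 * (b * x) / (b - 1)"
      using rounded_le[OF b that(1), of \<xi>] b by (intro divide_right_mono) auto
    moreover have "(if rounded b \<xi> y < rounded b \<xi> x then 2 * y else min y (rounded b \<xi> x)) \<le> 2 * y"
      using that by auto
    ultimately show ?thesis unfolding delay_def by linarith
  qed
  then have "(\<Sum>j<n. \<Sum>k<n. w j * w k * delay b \<xi> (r j) (r k)) \<le>
     (\<Sum>j<n. \<Sum>k<n. w j * w k * (2 * (b * r j) / (b - 1) + 2 * r k))"
    using pos r by (intro sum_mono mult_left_mono) (auto simp: less_imp_le)
  then show "\<bar>scaling_cost b n p w (\<sigma>, \<xi>)\<bar> \<le>
     (\<Sum>j<n. \<Sum>k<n. w j * w k * (2 * (b * r j) / (b - 1) + 2 * r k)) + (\<Sum>j<n. w j * p j)"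
    using scaling_cost_add_rev[OF perm, of \<xi>] scaling_cost_nonneg[OF perm, of \<xi>]
      scaling_cost_nonneg[OF rev, of \<xi>] by (simp add: r_def)
qed

end

section \<open>Measurability\<close>

text \<open>Coordinatewise measurability in the offset, which avoids a sigma-algebra on partial
  maps. The value at an uncompleted job is the constant \<open>the None\<close>.\<close>

definition kr_measurable :: "(real \<Rightarrow> kr_state) \<Rightarrow> bool" where
  "kr_measurable s \<longleftrightarrow> (\<lambda>\<xi>. fst (s \<xi>)) \<in> borel_measurable borel \<and>
     (\<forall>j. Measurable.pred borel (\<lambda>\<xi>. j \<in> dom (snd (s \<xi>))) \<and>
          (\<lambda>\<xi>. the (snd (s \<xi>) j)) \<in> borel_measurable borel)"

lemma kr_measurable_visit:
  assumes "kr_measurable s" "x \<in> borel_measurable borel"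
  shows "kr_measurable (\<lambda>\<xi>. visit p w (x \<xi>) j (s \<xi>))"
proof -
  have [measurable]: "(\<lambda>\<xi>. fst (s \<xi>)) \<in> borel_measurable borel"
    "\<And>k. Measurable.pred borel (\<lambda>\<xi>. k \<in> dom (snd (s \<xi>)))"
    "\<And>k. (\<lambda>\<xi>. the (snd (s \<xi>) k)) \<in> borel_measurable borel" "x \<in> borel_measurable borel"
    using assms by (auto simp: kr_measurable_def)
  have dom: "k \<in> dom (snd (visit p w (x \<xi>) j (s \<xi>))) \<longleftrightarrow>
      k \<in> dom (snd (s \<xi>)) \<or> k = j \<and> p j \<le> w j * x \<xi>" for k \<xi>
    by (auto simp: snd_visit)
  have the: "the (snd (visit p w (x \<xi>) j (s \<xi>)) k) =
      (if k = j \<and> j \<notin> dom (snd (s \<xi>)) \<and> p j \<le> w j * x \<xi> then fst (s \<xi>) + p j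
       else the (snd (s \<xi>) k))" for k \<xi>
    by (auto simp: snd_visit)
  show ?thesis
    unfolding kr_measurable_def fst_visit dom the by (intro conjI allI) measurable
qed

lemma kr_measurable_round:
  assumes "kr_measurable s"
  shows "kr_measurable (\<lambda>\<xi>. scaling_round b \<sigma> \<xi> p w q (s \<xi>))"
proof -
  have x: "(\<lambda>\<xi>. b powr (real_of_int q + \<xi>)) \<in> borel_measurable borel" by measurable
  show ?thesis
    unfolding scaling_round_visit using assms
  proof (induction \<sigma> arbitrary: s)
    case (Cons j \<sigma>)
    then show ?case using Cons.IH[OF kr_measurable_visit[OF Cons.prems x]] by simp
  qed simp
qed

lemma kr_measurable_run: "kr_measurable (\<lambda>\<xi>. scaling_run b \<sigma> \<xi> p w q0 q1)"
proof -
  have "kr_measurable (\<lambda>\<xi>. fold (scaling_round b \<sigma> \<xi> p w) qs (s \<xi>))" if "kr_measurable s" for qs s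
    using that
  proof (induction qs arbitrary: s)
    case (Cons q qs)
    then show ?case using Cons.IH[OF kr_measurable_round[OF Cons.prems]] by simp
  qed simp
  then show ?thesis by (simp add: scaling_run_def kr_measurable_def)
qed

text \<open>Expresses the definite description by countable operations, which preserve
  measurability. Completion times persist, so the rounds \<open>int i\<close> suffice and the
  sequence is eventually constant. If \<open>j\<close> never completes, the description has the
  fixed value \<open>THE c. False\<close>.\<close>

lemma completion_from_eq_lim:
  "completion_from b \<sigma> \<xi> p w q0 j =
    (if \<exists>i. j \<in> dom (snd (scaling_run b \<sigma> \<xi> p w q0 (int i)))
     then lim (\<lambda>i. the (snd (scaling_run b \<sigma> \<xi> p w q0 (int i)) j)) else (THE c. False))"
proof (cases "\<exists>i. j \<in> dom (snd (scaling_run b \<sigma> \<xi> p w q0 (int i)))")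
  case True
  then obtain i c where ic: "snd (scaling_run b \<sigma> \<xi> p w q0 (int i)) j = Some c" by blast
  then have "eventually (\<lambda>i. the (snd (scaling_run b \<sigma> \<xi> p w q0 (int i)) j) = c) sequentially"
    using scaling_run_Some_mono[OF ic] by (intro eventually_sequentiallyI[of i]) simp
  then have "lim (\<lambda>i. the (snd (scaling_run b \<sigma> \<xi> p w q0 (int i)) j)) = c"
    by (intro limI tendsto_eventually)
  then show ?thesis using True completion_from_eqI[OF ic] by simp
next
  case False
  have "snd (scaling_run b \<sigma> \<xi> p w q0 q) j \<noteq> Some c" for q c
  proof
    assume "snd (scaling_run b \<sigma> \<xi> p w q0 q) j = Some c"
    then have "snd (scaling_run b \<sigma> \<xi> p w q0 (int (nat q))) j = Some c"
      by (rule scaling_run_Some_mono) simp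
    with False show False by blast
  qed
  then show ?thesis using False by (simp add: completion_from_def)
qed

lemma measurable_completion_from:
  "(\<lambda>\<xi>. completion_from b \<sigma> \<xi> p w q0 j) \<in> borel_measurable borel"
proof -
  have [measurable]: "Measurable.pred borel (\<lambda>\<xi>. j \<in> dom (snd (scaling_run b \<sigma> \<xi> p w q0 q)))"
    "(\<lambda>\<xi>. the (snd (scaling_run b \<sigma> \<xi> p w q0 q) j)) \<in> borel_measurable borel" for q
    using kr_measurable_run by (auto simp: kr_measurable_def)
  show ?thesis unfolding completion_from_eq_lim by measurable
qed

text \<open>Turns the limit over starting rounds into the limit of a sequence, to which
  measurability of limits applies.\<close>

lemma at_bot_int: "(at_bot :: int filter) = filtermap (\<lambda>i. - int i) sequentially"
  unfolding filter_eq_iff eventually_filtermap eventually_at_bot_linorder eventually_sequentially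
proof (intro allI iffI)
  fix P :: "int \<Rightarrow> bool"
  assume "\<exists>N. \<forall>n\<le>N. P n"
  then obtain N where "\<And>n. n \<le> N \<Longrightarrow> P n" by blast
  then show "\<exists>N. \<forall>n\<ge>N. P (- int n)" by (intro exI[of _ "nat (- N)"]) auto
next
  fix P :: "int \<Rightarrow> bool"
  assume "\<exists>N. \<forall>n\<ge>N. P (- int n)"
  then obtain N where N: "\<And>n. n \<ge> N \<Longrightarrow> P (- int n)" by blast
  have "P m" if "m \<le> - int N" for m using N[of "nat (- m)"] that by simp
  then show "\<exists>N. \<forall>n\<le>N. P n" by blast
qed

lemma measurable_scaling_completion:
  "(\<lambda>\<xi>. scaling_completion b \<sigma> \<xi> p w j) \<in> borel_measurable borel"
proof -
  have "scaling_completion b \<sigma> \<xi> p w j = lim (\<lambda>i. completion_from b \<sigma> \<xi> p w (- int i) j)" for \<xi>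
    unfolding scaling_completion_def Topological_Spaces.Lim_def at_bot_int filterlim_filtermap ..
  then show ?thesis
    using measurable_completion_from by simp
qed

lemma sets_scaling_space: "sets (scaling_space n) = sets (count_space UNIV \<Otimes>\<^sub>M borel)"
  unfolding scaling_space_def by (intro sets_pair_measure_cong) auto

text \<open>All lists count here, not just orders of the jobs: the completion times of a job occurring
  twice or of a job outside the instance are measurable as well.\<close>

lemma measurable_scaling_cost: "scaling_cost b n p w \<in> borel_measurable (scaling_space n)"
  unfolding measurable_cong_sets[OF sets_scaling_space refl] scaling_cost_def
  using measurable_scaling_completion
  by (intro measurable_pair_measure_countable1) (auto intro!: borel_measurable_sum borel_measurable_times)

text \<open>Transfers the values computed as gauge integrals to the expectation over the offset,
  given Lebesgue integrability.\<close>

lemma integral_uniform_unit_interval: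
  fixes h :: "real \<Rightarrow> real"
  assumes "integrable (uniform_measure lborel {0..1}) h" "h \<in> borel_measurable borel"
    and I: "(h has_integral I) {0..1}"
  shows "integral\<^sup>L (uniform_measure lborel {0..1}) h = I"
proof -
  have U: "uniform_measure lborel {0..1::real} = density lborel (indicator {0..1} :: real \<Rightarrow> real)"
    by (simp add: uniform_measure_def divide_ennreal_def ennreal_indicator)
  have "set_integrable lborel {0..1} h"
    using assms unfolding U set_integrable_def by (subst (asm) integrable_density) auto
  then have "(LINT x:{0..1}|lborel. h x) = I"
    using I by (simp add: set_borel_integral_eq_integral integral_unique)
  moreover have "integral\<^sup>L (uniform_measure lborel {0..1}) h = (LINT x:{0..1}|lborel. h x)"
    using assms unfolding U set_lebesgue_integral_def by (subst integral_density) auto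
  ultimately show ?thesis by simp
qed

section \<open>The expected cost\<close>

lemma (in scaling_instance) expected_scaling_cost:
  "integrable (scaling_space n) (scaling_cost b n p w)"
  "integral\<^sup>L (scaling_space n) (scaling_cost b n p w) \<le> scaling_ratio b * OPT n p w"
proof -
  define A where "A = permutations_of_set {..<n}"
  define P where "P = measure_pmf (pmf_of_set A)"
  define U :: "real measure" where "U = uniform_measure lborel {0..1}"
  have A: "finite A" "A \<noteq> {}" by (simp_all add: A_def)
  interpret P: prob_space P unfolding P_def by (rule measure_pmf.prob_space_axioms)
  interpret U: prob_space U unfolding U_def by (intro prob_space_uniform_measure) auto
  interpret PU: pair_prob_space P U ..
  have space: "scaling_space n = P \<Otimes>\<^sub>M U" by (simp add: scaling_space_def P_def U_def A_def)
  have meas: "scaling_cost b n p w \<in> borel_measurable (P \<Otimes>\<^sub>M U)"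
    using measurable_scaling_cost[of b n p w] by (simp add: space)
  have meas1: "(\<lambda>\<xi>. scaling_cost b n p w (\<sigma>, \<xi>)) \<in> borel_measurable borel" for \<sigma>
    using measurable_scaling_completion unfolding scaling_cost_def
    by (auto intro!: borel_measurable_sum borel_measurable_times)
  obtain B where B: "\<And>\<sigma> \<xi>. \<sigma> \<in> A \<Longrightarrow> \<bar>scaling_cost b n p w (\<sigma>, \<xi>)\<bar> \<le> B"
    using scaling_cost_bounded unfolding A_def by blast
  have "AE x in P \<Otimes>\<^sub>M U. norm (scaling_cost b n p w x) \<le> B"
  proof (rule PU.AE_pair_measure)
    show "{x \<in> space (P \<Otimes>\<^sub>M U). norm (scaling_cost b n p w x) \<le> B} \<in> sets (P \<Otimes>\<^sub>M U)"
      using meas by measurable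
    show "AE \<sigma> in P. AE \<xi> in U. norm (scaling_cost b n p w (\<sigma>, \<xi>)) \<le> B"
      using A B unfolding P_def by (simp add: AE_measure_pmf_iff)
  qed
  then have int: "integrable (P \<Otimes>\<^sub>M U) (scaling_cost b n p w)"
    using meas by (intro PU.integrable_const_bound)
  then show "integrable (scaling_space n) (scaling_cost b n p w)" by (simp add: space)
  have int1: "integrable U (\<lambda>\<xi>. scaling_cost b n p w (\<sigma>, \<xi>))" if "\<sigma> \<in> A" for \<sigma>
    using B[OF that] meas1[of \<sigma>] by (intro U.integrable_const_bound[of _ B]) (auto simp: U_def)
  define C where "C \<sigma> = integral\<^sup>L U (\<lambda>\<xi>. scaling_cost b n p w (\<sigma>, \<xi>))" for \<sigma>
  have rev: "rev \<sigma> \<in> A" if "\<sigma> \<in> A" for \<sigma>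
    using that by (simp add: A_def permutations_of_set_def)
  have pair: "C \<sigma> + C (rev \<sigma>) \<le> 2 * (scaling_ratio b * OPT n p w)" if "\<sigma> \<in> A" for \<sigma>
  proof -
    obtain I where I: "((\<lambda>\<xi>. \<Sum>j<n. \<Sum>k<n. w j * w k * delay b \<xi> (p j / w j) (p k / w k)) has_integral I) {0..1}"
      and I_le: "I \<le> scaling_ratio b * (\<Sum>j<n. \<Sum>k<n. w j * w k * min (p j / w j) (p k / w k))"
      using integral_delay_le[OF b, of "{..<n}" "\<lambda>j. p j / w j" w] pos by auto
    have "((\<lambda>\<xi>. scaling_cost b n p w (\<sigma>, \<xi>) + scaling_cost b n p w (rev \<sigma>, \<xi>)) has_integral
        I + (\<Sum>j<n. w j * p j)) {0..1}"
      unfolding scaling_cost_add_rev[OF that[unfolded A_def]]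
      using has_integral_add[OF I has_integral_const_real[of "\<Sum>j<n. w j * p j" 0 1]] by simp
    moreover have "integrable U (\<lambda>\<xi>. scaling_cost b n p w (\<sigma>, \<xi>) + scaling_cost b n p w (rev \<sigma>, \<xi>))"
      using int1[OF that] int1[OF rev[OF that]] by simp
    ultimately have "integral\<^sup>L U (\<lambda>\<xi>. scaling_cost b n p w (\<sigma>, \<xi>) + scaling_cost b n p w (rev \<sigma>, \<xi>)) =
        I + (\<Sum>j<n. w j * p j)"
      unfolding U_def using meas1 by (intro integral_uniform_unit_interval) auto
    then have "C \<sigma> + C (rev \<sigma>) = I + (\<Sum>j<n. w j * p j)"
      using int1[OF that] int1[OF rev[OF that]] by (simp add: C_def)
    \<comment> \<open>Nonnegativity and a ratio of at least 1 permit multiplying this term by the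
      ratio too, which produces the quantity bounded by twice the optimum.\<close>
    also have "0 \<le> (\<Sum>j<n. w j * p j)" using pos by (intro sum_nonneg) (simp add: less_imp_le)
    then have "I + (\<Sum>j<n. w j * p j) \<le> scaling_ratio b *
        ((\<Sum>j<n. \<Sum>k<n. w j * w k * min (p j / w j) (p k / w k)) + (\<Sum>j<n. w j * p j))"
      unfolding distrib_left using mult_right_mono[OF scaling_ratio_ge_1[OF b]] I_le
      by (intro add_mono) auto
    also have "\<dots> \<le> scaling_ratio b * (2 * OPT n p w)"
      using OPT_ge[OF ok] scaling_ratio_ge_1[OF b] by (intro mult_left_mono) auto
    finally show ?thesis by simp
  qed
  \<comment> \<open>Reversal is an involution on the orders, so averaging the bound for pairs over
    all orders bounds twice the mean cost.\<close>
  have "(\<Sum>\<sigma>\<in>A. C (rev \<sigma>)) = (\<Sum>\<sigma>\<in>A. C \<sigma>)"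
    by (rule sum.reindex_bij_witness[of _ rev rev]) (auto simp: rev)
  then have "2 * (\<Sum>\<sigma>\<in>A. C \<sigma>) = (\<Sum>\<sigma>\<in>A. C \<sigma> + C (rev \<sigma>))"
    by (simp add: sum.distrib)
  also have "\<dots> \<le> real (card A) * (2 * (scaling_ratio b * OPT n p w))"
    using pair by (rule sum_bounded_above)
  finally have "(\<Sum>\<sigma>\<in>A. C \<sigma>) / real (card A) \<le> scaling_ratio b * OPT n p w"
    using A by (simp add: divide_le_eq card_gt_0_iff mult_ac)
  moreover have "integral\<^sup>L (P \<Otimes>\<^sub>M U) (scaling_cost b n p w) = (\<Sum>\<sigma>\<in>A. C \<sigma>) / real (card A)"
    using A unfolding PU.integral_fst'[OF int, symmetric] C_def[symmetric]
    by (simp add: P_def integral_pmf_of_set)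
  ultimately show "integral\<^sup>L (scaling_space n) (scaling_cost b n p w) \<le> scaling_ratio b * OPT n p w"
    by (simp add: space)
qed

theorem theorem1p4:
  shows "(\<forall>b>1. \<forall>n p w. instance_ok n p w \<longrightarrow>
            integrable (scaling_space n) (scaling_cost b n p w) \<and>
            integral\<^sup>L (scaling_space n) (scaling_cost b n p w) \<le> scaling_ratio b * OPT n p w) \<and>
         (\<exists>b0>1. (\<forall>b>1. b \<noteq> b0 \<longrightarrow> scaling_ratio b0 < scaling_ratio b) \<and>
            \<bar>b0 - 8.16\<bar> \<le> 0.005 \<and> scaling_ratio b0 < 3.032)"
  using scaling_instance.expected_scaling_cost scaling_ratio_minimum
  by (auto simp: scaling_instance_def)

end
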